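(* Let $M$ and $N$ be nonempty bounded closed convex subsets of a uniformly convex Banach space $X$, and suppose $F: M\cup N\to M\cup N$ satisfies (1) $F(M)\subseteq M$ and $F(N)\subseteq N$; and (2) $\|Fw-Fz\|\le\|w-z\|$ for all $w\in M$, $z\in N$. Let $\epsilon\in(0,1/2)$, let $\eta_n,\delta_n\in(\epsilon,1-\epsilon)$ for $n=0,1,2,\dots$, let $w_0\in M$, and define $$w_{n+1}=(1-\eta_n)w_n+\eta_n F\big((1-\delta_n)w_n+\delta_n Fw_n\big),\qquad n=0,1,2,\dots.$$ Suppose $d(w_n,M_0)\to 0$. Then $\lim_{n\to\infty}\|w_n-Fw_n\|=0$. Moreover, if $F(M)$ lies in a compact set, then $\{w_n\}$ converges (in norm) to a fixed point of $F$.
   Context: For subsets $M,N$ of a normed space: $d(M,N)=\inf\{\|w-z\|: w\in M, z\in N\}$; $d(w,A)=\inf\{\|w-a\|:a\in A\}$ is the distance from a point to a set; and $M_0=\{w\in M:\|w-z'\|=d(M,N)\text{ for some } z'\in N\}$. The map $F$ is not assumed to be continuous. *)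

theory Defs
  imports "HOL-Analysis.Analysis"
begin

text \<open>
  Uniform convexity in Clarkson's form, via pairs of unit vectors. It is a property of the
  normed space carried by the type \<open>'a\<close>, hence the type argument.
\<close>

definition uniformly_convex :: "'a::real_normed_vector itself \<Rightarrow> bool" where
  "uniformly_convex _ \<longleftrightarrow>
    (\<forall>e>0. \<exists>d>0. \<forall>x y :: 'a.
      norm x = 1 \<longrightarrow> norm y = 1 \<longrightarrow> norm (x - y) \<ge> e \<longrightarrow> norm ((x + y) /\<^sub>R 2) \<le> 1 - d)"

text \<open>
  The set \<open>M\<^sub>0\<close> of points of \<open>M\<close> at which the distance to \<open>N\<close> is attained and equals
  \<open>d(M, N)\<close>. Note that \<^const>\<open>setdist\<close> and \<^const>\<open>infdist\<close> take the value 0 on empty sets. This is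
  harmless below: \<open>M\<close> and \<open>N\<close> are nonempty, and in a uniformly convex Banach space \<open>M\<^sub>0\<close> is
  nonempty as soon as \<open>M\<close> and \<open>N\<close> are nonempty, bounded, closed and convex.
\<close>

definition proximal_points :: "'a::real_normed_vector set \<Rightarrow> 'a set \<Rightarrow> 'a set" where
  "proximal_points M N = {w \<in> M. \<exists>z\<in>N. norm (w - z) = setdist M N}"

end

theory Submission
  imports Defs
begin

text \<open>
  The key is to compare the iterates with fixed points of \<open>F\<close> in the \<^emph>\<open>other\<close> set. On \<open>M\<close> alone
  nothing is known about \<open>F\<close>, but if \<open>q \<in> N\<close> and \<open>F q = q\<close>, then \<open>F\<close> does not increase the distance
  of points of \<open>M\<close> to \<open>q\<close>. Such a \<open>q\<close> exists: for an orbit of \<open>F\<close> in \<open>M\<close>, the limit superior of the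
  distances to a point \<open>y \<in> N\<close> is a convex function of \<open>y\<close> which does not increase when \<open>F\<close> is
  applied to \<open>y\<close>. Uniform convexity yields a unique minimizer of it, which \<open>F\<close> must therefore fix
  (\<open>fixed_point_by_asymptotic_center\<close>).

  The distances from \<open>w n\<close> to \<open>q\<close> decrease, say to \<open>r\<close>. The inner step of the iteration is a
  combination of \<open>w n\<close> and \<open>F (w n)\<close>, whose distances to \<open>q\<close> are at most slightly above \<open>r\<close>, and it
  is itself at distance nearly \<open>r\<close> or more, so uniform convexity makes \<open>w n - F (w n)\<close> tend to \<open>0\<close>
  (\<open>asymptotically_regular\<close>).

  If \<open>F ` M\<close> lies in a compact set, some iterates converge to a point \<open>p \<in> M\<close>, and the hypothesis on
  the distance to the proximal points gives \<open>p\<close> a partner \<open>z \<in> N\<close> at distance \<open>setdist M N\<close>; here it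
  matters that proximal points exist (\<open>proximal_points_nonempty\<close>). In place of continuity, the
  uniqueness of nearest points shows \<open>F p = p\<close> and \<open>F z = z\<close> (\<open>proximal_cluster_point_fixed\<close>). Now
  \<open>z\<close> may play the role of \<open>q\<close>: all distances \<open>norm (w n - z)\<close> tend to \<open>setdist M N\<close>, and by uniform
  convexity that is possible only if \<open>w n\<close> tends to the point of \<open>M\<close> nearest to \<open>z\<close>, namely \<open>p\<close>.

  The minimizers are found without weak compactness, from the fact that decreasing sequences of
  nonempty bounded closed convex sets in a uniformly convex Banach space intersect.
\<close>

section \<open>Uniform convexity for points that are nearly on a sphere\<close>

lemma uniformly_convex_unit_ball:
  assumes uc: "uniformly_convex TYPE('a::real_normed_vector)" and "0 < e"
  obtains \<gamma> where "0 < \<gamma>"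
    "\<And>x y :: 'a. norm x \<le> 1 \<Longrightarrow> norm y \<le> 1 \<Longrightarrow> e \<le> norm (x - y) \<Longrightarrow> norm (x + y) \<le> 2 - \<gamma>"
proof -
  from uc \<open>0 < e\<close> have "e / 2 > 0 \<Longrightarrow> \<exists>d>0. \<forall>x y :: 'a. norm x = 1 \<longrightarrow> norm y = 1 \<longrightarrow>
      norm (x - y) \<ge> e / 2 \<longrightarrow> norm ((x + y) /\<^sub>R 2) \<le> 1 - d"
    unfolding uniformly_convex_def by blast
  then obtain d where "0 < d" and d: "\<And>x y :: 'a. norm x = 1 \<Longrightarrow> norm y = 1 \<Longrightarrow>
      e / 2 \<le> norm (x - y) \<Longrightarrow> norm ((x + y) /\<^sub>R 2) \<le> 1 - d"
    using \<open>0 < e\<close> by auto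
  \<comment> \<open>Points of norm at most \<open>1 - \<tau>\<close> gain \<open>\<tau>\<close> outright; the others are moved to the sphere at a
    cost of \<open>\<tau>\<close> each, which must leave a distance \<open>e / 2\<close> and a gain \<open>d\<close>.\<close>
  define \<tau> where "\<tau> = min (min (e / 4) (d / 2)) (1 / 2)"
  have \<tau>: "0 < \<tau>" "\<tau> \<le> e / 4" "\<tau> \<le> d / 2" "\<tau> \<le> 1 / 2"
    using \<open>0 < e\<close> \<open>0 < d\<close> by (auto simp: \<tau>_def)
  have "norm (x + y) \<le> 2 - \<tau>"
    if x: "norm x \<le> 1" and y: "norm y \<le> 1" and xy: "e \<le> norm (x - y)" for x y :: 'a
  proof (cases "norm x \<le> 1 - \<tau> \<or> norm y \<le> 1 - \<tau>")
    case True
    then show ?thesis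
      using norm_triangle_ineq[of x y] x y by auto
  next
    case False
    define x' where "x' = x /\<^sub>R norm x"
    define y' where "y' = y /\<^sub>R norm y"
    have near: "norm (v - v /\<^sub>R norm v) \<le> \<tau>" if "norm v \<le> 1" "1 - \<tau> < norm v" for v :: 'a
    proof -
      have "0 < norm v"
        using that(2) \<tau>(4) by linarith
      have "v - v /\<^sub>R norm v = (1 - inverse (norm v)) *\<^sub>R v"
        by (simp add: scaleR_left_diff_distrib)
      then have "norm (v - v /\<^sub>R norm v) = \<bar>1 - inverse (norm v)\<bar> * norm v"
        by simp
      also have "\<dots> = \<bar>norm v - 1\<bar>"
        using \<open>0 < norm v\<close> by (simp add: abs_mult_pos' field_simps)
      finally show ?thesis
        using that by linarith
    qed
    have "x \<noteq> 0" "y \<noteq> 0"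
      using False \<tau>(4) by auto
    then have unit: "norm x' = 1" "norm y' = 1"
      by (auto simp: x'_def y'_def)
    have close: "norm (x - x') \<le> \<tau>" "norm (y - y') \<le> \<tau>"
      using near[of x] near[of y] False x y by (auto simp: x'_def y'_def)
    have "norm (x - y) \<le> norm (x - x') + norm (x' - y') + norm (y - y')"
      using norm_triangle_ineq[of "x - x'" "x' - y'"] norm_triangle_ineq4[of "x - y'" "y - y'"]
      by simp
    then have "e / 2 \<le> norm (x' - y')"
      using close xy \<tau>(2) by linarith
    then have "norm ((x' + y') /\<^sub>R 2) \<le> 1 - d"
      by (rule d[OF unit])
    then have "norm (x' + y') \<le> 2 - 2 * d"
      by simp
    moreover have "norm (x + y) \<le> norm (x' + y') + norm (x - x') + norm (y - y')"
      using norm_triangle_ineq[of "x' + y'" "(x - x') + (y - y')"]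
        norm_triangle_ineq[of "x - x'" "y - y'"] by (simp add: algebra_simps)
    ultimately show ?thesis
      using close \<tau> by linarith
  qed
  with \<open>0 < \<tau>\<close> show ?thesis
    by (rule that)
qed

lemma uniformly_convex_unit_ball_combination:
  assumes uc: "uniformly_convex TYPE('a::real_normed_vector)" and "0 < e" and "0 < \<epsilon>"
  obtains \<gamma> where "0 < \<gamma>"
    "\<And>(x :: 'a) y t. norm x \<le> 1 \<Longrightarrow> norm y \<le> 1 \<Longrightarrow> e \<le> norm (x - y) \<Longrightarrow> t \<in> {\<epsilon>..1 - \<epsilon>} \<Longrightarrow>
      norm ((1 - t) *\<^sub>R x + t *\<^sub>R y) \<le> 1 - \<gamma>"
proof -
  obtain \<gamma> where "0 < \<gamma>" and \<gamma>: "\<And>x y :: 'a. norm x \<le> 1 \<Longrightarrow> norm y \<le> 1 \<Longrightarrow>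
      e \<le> norm (x - y) \<Longrightarrow> norm (x + y) \<le> 2 - \<gamma>"
    using uniformly_convex_unit_ball[OF uc \<open>0 < e\<close>] by blast
  \<comment> \<open>The combination contains the share \<open>s\<close>, at least \<open>\<epsilon>\<close>, of \<open>x + y\<close>; the rest is a multiple
    of one of the two points.\<close>
  have half: "norm ((1 - s) *\<^sub>R x + s *\<^sub>R y) \<le> 1 - \<epsilon> * \<gamma>"
    if "norm x \<le> 1" "norm y \<le> 1" "e \<le> norm (x - y)" "\<epsilon> \<le> s" "s \<le> 1 / 2" for x y :: 'a and s
  proof -
    have "(1 - s) *\<^sub>R x + s *\<^sub>R y = (1 - 2 * s) *\<^sub>R x + s *\<^sub>R (x + y)"
      by (simp add: algebra_simps flip: scaleR_add_left)
    then have "norm ((1 - s) *\<^sub>R x + s *\<^sub>R y) \<le> (1 - 2 * s) * norm x + s * norm (x + y)"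
      using norm_triangle_ineq[of "(1 - 2 * s) *\<^sub>R x" "s *\<^sub>R (x + y)"] that \<open>0 < \<epsilon>\<close> by simp
    also have "\<dots> \<le> (1 - 2 * s) * 1 + s * (2 - \<gamma>)"
      using that \<open>0 < \<epsilon>\<close> \<gamma>[of x y] by (intro add_mono mult_left_mono) auto
    also have "\<dots> = 1 - s * \<gamma>"
      by (simp add: algebra_simps)
    also have "\<dots> \<le> 1 - \<epsilon> * \<gamma>"
      using that \<open>0 < \<gamma>\<close> by (simp add: mult_right_mono)
    finally show ?thesis .
  qed
  show ?thesis
  proof (rule that[of "\<epsilon> * \<gamma>"])
    fix x y :: 'a and t
    assume *: "norm x \<le> 1" "norm y \<le> 1" "e \<le> norm (x - y)" "t \<in> {\<epsilon>..1 - \<epsilon>}"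
    show "norm ((1 - t) *\<^sub>R x + t *\<^sub>R y) \<le> 1 - \<epsilon> * \<gamma>"
    proof (cases "t \<le> 1 / 2")
      case True
      then show ?thesis
        using half[of x y t] * by auto
    next
      case False
      then show ?thesis
        using half[of y x "1 - t"] * by (auto simp: norm_minus_commute add.commute)
    qed
  qed (use \<open>0 < \<gamma>\<close> \<open>0 < \<epsilon>\<close> in auto)
qed

text \<open>
  Uniform convexity enters the rest of the argument only in this form: if two points barely leave
  the ball of radius \<open>R\<close> while a combination with weights bounded away from \<open>0\<close> stays close to its
  boundary, then the points are close. A single slack \<open>h\<close> serves for both sides of the radius, so
  that nothing has to be rescaled later, and \<open>R = 0\<close> is no exceptional case.
\<close>

lemma uniformly_convex_annulus:
  assumes uc: "uniformly_convex TYPE('a::real_normed_vector)" and "0 < e" and "0 < \<epsilon>"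
  obtains h where "0 < h"
    "\<And>(x :: 'a) y t. norm x \<le> R + h \<Longrightarrow> norm y \<le> R + h \<Longrightarrow> t \<in> {\<epsilon>..1 - \<epsilon>} \<Longrightarrow>
      R - h \<le> norm ((1 - t) *\<^sub>R x + t *\<^sub>R y) \<Longrightarrow> norm (x - y) < e"
proof (cases "R \<le> 0")
  case True
  show ?thesis
  proof (rule that[of "e / 3"])
    fix x y :: 'a
    assume "norm x \<le> R + e / 3" "norm y \<le> R + e / 3"
    then show "norm (x - y) < e"
      using True \<open>0 < e\<close> norm_triangle_ineq4[of x y] by linarith
  qed (use \<open>0 < e\<close> in simp)
next
  case False
  then have "0 < R"
    by simp
  then have "0 < e / (2 * R)"
    using \<open>0 < e\<close> by simp
  then obtain \<gamma> where "0 < \<gamma>" and \<gamma>: "\<And>(x :: 'a) y t. norm x \<le> 1 \<Longrightarrow> norm y \<le> 1 \<Longrightarrow>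
      e / (2 * R) \<le> norm (x - y) \<Longrightarrow> t \<in> {\<epsilon>..1 - \<epsilon>} \<Longrightarrow> norm ((1 - t) *\<^sub>R x + t *\<^sub>R y) \<le> 1 - \<gamma>"
    using uniformly_convex_unit_ball_combination[OF uc _ \<open>0 < \<epsilon>\<close>] by blast
  \<comment> \<open>After scaling by \<open>R + h\<close>, at most \<open>2 * R\<close>, the norm of the combination is at most
    \<open>(R + h) * (1 - \<gamma>)\<close>, which is less than \<open>R - h\<close>.\<close>
  define h where "h = min R (\<gamma> * R / 2)"
  have h: "0 < h" "h \<le> R" "2 * h \<le> \<gamma> * R"
    using \<open>0 < R\<close> \<open>0 < \<gamma>\<close> by (auto simp: h_def)
  show ?thesis
  proof (rule that[of h])
    fix x y :: 'a and t
    assume x: "norm x \<le> R + h" and y: "norm y \<le> R + h" and t: "t \<in> {\<epsilon>..1 - \<epsilon>}"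
      and far: "R - h \<le> norm ((1 - t) *\<^sub>R x + t *\<^sub>R y)"
    show "norm (x - y) < e"
    proof (rule ccontr)
      assume "\<not> norm (x - y) < e"
      then have "e \<le> norm (x - y)"
        by simp
      define s where "s = R + h"
      have s: "0 < s" "s \<le> 2 * R"
        using \<open>0 < R\<close> h by (auto simp: s_def)
      have "e / (2 * R) \<le> e / s"
        using s \<open>0 < e\<close> \<open>0 < R\<close> by (intro divide_left_mono) auto
      also have "\<dots> \<le> norm (x - y) / s"
        using s \<open>e \<le> norm (x - y)\<close> by (simp add: divide_right_mono)
      also have "\<dots> = norm (x /\<^sub>R s - y /\<^sub>R s)"
        using s by (simp add: divide_inverse_commute flip: scaleR_diff_right)
      finally have "norm ((1 - t) *\<^sub>R (x /\<^sub>R s) + t *\<^sub>R (y /\<^sub>R s)) \<le> 1 - \<gamma>"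
        using x y s t by (intro \<gamma>) (auto simp: s_def field_simps)
      moreover have "(1 - t) *\<^sub>R (x /\<^sub>R s) + t *\<^sub>R (y /\<^sub>R s) = ((1 - t) *\<^sub>R x + t *\<^sub>R y) /\<^sub>R s"
        by (simp add: scaleR_add_right mult.commute)
      ultimately have "norm ((1 - t) *\<^sub>R x + t *\<^sub>R y) / s \<le> 1 - \<gamma>"
        using s by (simp add: divide_inverse_commute)
      then have "norm ((1 - t) *\<^sub>R x + t *\<^sub>R y) \<le> (1 - \<gamma>) * s"
        using s by (simp add: pos_divide_le_eq)
      also have "\<dots> = R + h - \<gamma> * R - \<gamma> * h"
        by (simp add: s_def algebra_simps)
      also have "\<dots> < R - h"
        using h \<open>0 < \<gamma>\<close> mult_pos_pos[of \<gamma> h] by linarith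
      finally show False
        using far by simp
    qed
  qed (rule h)
qed

text \<open>
  A proximal point attracts every sequence of \<open>C\<close> that realizes its distance to \<open>z\<close>: midpoints stay
  in \<open>C\<close>, hence at distance at least \<open>D\<close> from \<open>z\<close>. Constant sequences give uniqueness.
\<close>

lemma uniformly_convex_nearest_point_attracts:
  fixes C :: "'a::real_normed_vector set"
  assumes uc: "uniformly_convex TYPE('a)" and "convex C"
    and D: "\<And>x. x \<in> C \<Longrightarrow> D \<le> norm (x - z)"
    and p: "p \<in> C" "norm (p - z) \<le> D"
    and y: "\<And>n :: nat. y n \<in> C" "(\<lambda>n. norm (y n - z)) \<longlonglongrightarrow> D"
  shows "y \<longlonglongrightarrow> p"
proof (rule LIMSEQ_I)
  fix e :: real
  assume "0 < e"
  obtain h where "0 < h" and h: "\<And>(x :: 'a) y t. norm x \<le> D + h \<Longrightarrow> norm y \<le> D + h \<Longrightarrow>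
      t \<in> {1/2..1 - 1/2} \<Longrightarrow> D - h \<le> norm ((1 - t) *\<^sub>R x + t *\<^sub>R y) \<Longrightarrow> norm (x - y) < e"
    using uniformly_convex_annulus[OF uc \<open>0 < e\<close>, of "1/2" D] by (metis half_gt_zero_iff zero_less_one)
  from y(2) \<open>0 < h\<close> have "\<forall>\<^sub>F n in sequentially. norm (y n - z) < D + h"
    by (intro order_tendstoD) auto
  then obtain N where N: "\<And>n. n \<ge> N \<Longrightarrow> norm (y n - z) < D + h"
    by (auto simp: eventually_sequentially)
  have "norm (y n - p) < e" if "n \<ge> N" for n
  proof -
    have "(1/2) *\<^sub>R y n + (1/2) *\<^sub>R p \<in> C"
      using \<open>convex C\<close> y(1) p(1) by (intro convexD) auto
    from D[OF this] have "D - h \<le> norm ((1 - 1/2) *\<^sub>R (y n - z) + (1/2) *\<^sub>R (p - z))"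
      using \<open>0 < h\<close> by (simp add: algebra_simps flip: scaleR_add_left)
    then have "norm ((y n - z) - (p - z)) < e"
      using N[OF that] p(2) \<open>0 < h\<close> by (intro h[of _ _ "1/2"]) auto
    then show ?thesis
      by simp
  qed
  then show "\<exists>N. \<forall>n\<ge>N. norm (y n - p) < e"
    by blast
qed

corollary uniformly_convex_nearest_point_unique:
  fixes C :: "'a::real_normed_vector set"
  assumes "uniformly_convex TYPE('a)" "convex C" "\<And>x. x \<in> C \<Longrightarrow> D \<le> norm (x - z)"
    and "p \<in> C" "norm (p - z) \<le> D" "p' \<in> C" "norm (p' - z) \<le> D"
  shows "p' = p"
proof -
  have "norm (p' - z) = D"
    using assms(3)[of p'] assms(6,7) by simp
  then have "(\<lambda>_::nat. p') \<longlonglongrightarrow> p"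
    using assms by (intro uniformly_convex_nearest_point_attracts[where C = C and D = D]) auto
  then show ?thesis
    by (simp add: LIMSEQ_const_iff)
qed

section \<open>Minima of convex functions\<close>

lemma infdist_less_witness:
  assumes "infdist x A < b" "A \<noteq> {}"
  obtains a where "a \<in> A" "dist x a < b"
proof -
  have "\<exists>a\<in>A. dist x a < b"
    using assms cINF_less_iff[of A "dist x" b] by (auto simp: infdist_notempty)
  then show ?thesis
    using that by blast
qed

text \<open>
  This replaces weak compactness. Almost shortest vectors of the sets \<open>C n\<close> have norms that
  converge to the limit of the distances of the \<open>C n\<close> from \<open>0\<close>. By nestedness and convexity their
  midpoints are not much shorter, so these vectors form a Cauchy sequence.
\<close>

lemma uniformly_convex_decseq_Inter_nonempty:
  fixes C :: "nat \<Rightarrow> 'a::banach set"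
  assumes uc: "uniformly_convex TYPE('a)" and "decseq C" and "bounded (C 0)"
    and C: "\<And>n. C n \<noteq> {}" "\<And>n. closed (C n)" "\<And>n. convex (C n)"
  shows "(\<Inter>n. C n) \<noteq> {}"
proof -
  have mono: "C n \<subseteq> C m" if "m \<le> n" for m n
    using \<open>decseq C\<close> that by (auto simp: decseq_def)
  define r where "r n = infdist 0 (C n)" for n
  have r_le: "r n \<le> norm x" if "x \<in> C n" for n x
    using infdist_le[OF that, of 0] by (simp add: r_def)
  have "incseq r"
    using infdist_mono[OF mono C(1)] by (auto simp: incseq_def r_def)
  from \<open>bounded (C 0)\<close> obtain B where B: "\<And>x. x \<in> C 0 \<Longrightarrow> norm x \<le> B"
    by (auto simp: bounded_iff)
  have "r n \<le> B" for n
  proof -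
    obtain x where "x \<in> C n"
      using C(1) by blast
    then show ?thesis
      using r_le[of x n] B[of x] mono[of 0 n] by fastforce
  qed
  then obtain R where "r \<longlonglongrightarrow> R" and r_R: "\<And>n. r n \<le> R"
    using incseq_convergent[OF \<open>incseq r\<close>] by metis
  have "\<exists>x\<in>C n. norm x < R + inverse (real (Suc n))" for n
  proof -
    have "infdist 0 (C n) < R + inverse (real (Suc n))"
      using r_R[of n] unfolding r_def by (rule le_less_trans) simp
    then show ?thesis
      using C(1) by (rule infdist_less_witness) auto
  qed
  then obtain x where x: "\<And>n. x n \<in> C n" "\<And>n. norm (x n) < R + inverse (real (Suc n))"
    by metis
  have "Cauchy x"
  proof (rule CauchyI)
    fix e :: real
    assume "0 < e"
    obtain h where "0 < h" and h: "\<And>(x :: 'a) y t. norm x \<le> R + h \<Longrightarrow> norm y \<le> R + h \<Longrightarrow>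
        t \<in> {1/2..1 - 1/2} \<Longrightarrow> R - h \<le> norm ((1 - t) *\<^sub>R x + t *\<^sub>R y) \<Longrightarrow> norm (x - y) < e"
      using uniformly_convex_annulus[OF uc \<open>0 < e\<close>, of "1/2" R] by (metis half_gt_zero_iff zero_less_one)
    have "\<forall>\<^sub>F n in sequentially. inverse (real (Suc n)) < h"
      using LIMSEQ_inverse_real_of_nat \<open>0 < h\<close> by (rule order_tendstoD)
    moreover have "\<forall>\<^sub>F n in sequentially. R - h < r n"
      using \<open>r \<longlonglongrightarrow> R\<close> \<open>0 < h\<close> by (intro order_tendstoD) auto
    ultimately have "\<forall>\<^sub>F n in sequentially. inverse (real (Suc n)) < h \<and> R - h < r n"
      by (rule eventually_conj)
    then obtain k where k: "\<And>n. n \<ge> k \<Longrightarrow> inverse (real (Suc n)) < h \<and> R - h < r n"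
      by (auto simp: eventually_sequentially)
    have "norm (x m - x n) < e" if "m \<ge> k" "n \<ge> k" for m n
    proof (rule h[of _ _ "1/2"])
      have "(1 - 1/2) *\<^sub>R x m + (1/2) *\<^sub>R x n \<in> C k"
        using x(1) mono[OF that(1)] mono[OF that(2)] by (intro convexD[OF C(3)]) auto
      then show "R - h \<le> norm ((1 - 1/2) *\<^sub>R x m + (1/2) *\<^sub>R x n)"
        using r_le[of _ k] k[of k] by fastforce
    qed (use k[of m] k[of n] x(2)[of m] x(2)[of n] that in auto)
    then show "\<exists>k. \<forall>m\<ge>k. \<forall>n\<ge>k. norm (x m - x n) < e"
      by blast
  qed
  then obtain a where "x \<longlonglongrightarrow> a"
    using Cauchy_convergent convergent_def by blast
  have "a \<in> C n" for n
  proof (rule Lim_in_closed_set[OF C(2)])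
    show "\<forall>\<^sub>F m in sequentially. x m \<in> C n"
      using x(1) mono by (intro eventually_sequentiallyI[of n]) blast
    show "x \<longlonglongrightarrow> a" by fact
  qed simp
  then show ?thesis
    by blast
qed

lemma uniformly_convex_attains_min:
  fixes f :: "'a::banach \<Rightarrow> real"
  assumes uc: "uniformly_convex TYPE('a)"
    and C: "C \<noteq> {}" "bounded C" "closed C"
    and f: "convex_on C f" "continuous_on C f" "bdd_below (f ` C)"
  obtains x where "x \<in> C" "\<And>y. y \<in> C \<Longrightarrow> f x \<le> f y"
proof -
  define m where "m = Inf (f ` C)"
  define S where "S n = {x \<in> C. f x \<le> m + inverse (real (Suc n))}" for n
  have "(\<Inter>n. S n) \<noteq> {}"
  proof (rule uniformly_convex_decseq_Inter_nonempty[OF uc])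
    have "S k \<subseteq> S n" if "n \<le> k" for n k
    proof
      fix x
      assume x: "x \<in> S k"
      have "inverse (real (Suc k)) \<le> inverse (real (Suc n))"
        using that by (intro le_imp_inverse_le) auto
      then have "m + inverse (real (Suc k)) \<le> m + inverse (real (Suc n))"
        by (rule add_left_mono)
      with x show "x \<in> S n"
        unfolding S_def by (blast intro: order_trans)
    qed
    then show "decseq S"
      by (simp add: decseq_def)
    show "bounded (S 0)"
      using \<open>bounded C\<close> by (rule bounded_subset) (auto simp: S_def)
    fix n
    have "Inf (f ` C) < m + inverse (real (Suc n))"
      by (simp add: m_def)
    from cInf_lessD[OF _ this] show "S n \<noteq> {}"
      using C(1) by (force simp: S_def)
    show "closed (S n)"
      using continuous_on_closed_Collect_le[OF f(2) continuous_on_const C(3)] by (simp add: S_def)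
    show "convex (S n)"
    proof (rule convexI)
      fix x y and u v :: real
      assume *: "x \<in> S n" "y \<in> S n" "0 \<le> u" "0 \<le> v" "u + v = 1"
      have "u *\<^sub>R x + v *\<^sub>R y \<in> C"
        using * convexD[OF convex_on_imp_convex[OF f(1)]] by (auto simp: S_def)
      moreover have "f (u *\<^sub>R x + v *\<^sub>R y) \<le> max (f x) (f y)"
        using * by (intro convex_lower[OF f(1)]) (auto simp: S_def)
      ultimately show "u *\<^sub>R x + v *\<^sub>R y \<in> S n"
        using * by (auto simp: S_def simp del: of_nat_Suc)
    qed
  qed
  then obtain x where x: "\<And>n. x \<in> S n"
    by blast
  have "f x \<le> m + inverse (real (Suc n))" for n
    using x[of n] by (simp add: S_def)
  moreover have "(\<lambda>n. m + inverse (real (Suc n))) \<longlonglongrightarrow> m"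
    using LIMSEQ_inverse_real_of_nat_add[of m] by simp
  ultimately have "f x \<le> m"
    by (intro LIMSEQ_le_const[where X = "\<lambda>n. m + inverse (real (Suc n))"]) auto
  moreover have "m \<le> f y" if "y \<in> C" for y
    using that f(3) by (auto simp: m_def intro: cInf_lower)
  ultimately show ?thesis
    using x[of 0] by (intro that[of x]) (auto simp: S_def intro: order_trans)
qed

section \<open>Proximal points\<close>

lemma convex_on_infdist:
  fixes A :: "'a::real_normed_vector set"
  assumes "convex A" "A \<noteq> {}" "convex S"
  shows "convex_on S (\<lambda>x. infdist x A)"
proof (rule convex_onI)
  fix t :: real and x y :: 'a
  assume t: "0 < t" "t < 1"
  show "infdist ((1 - t) *\<^sub>R x + t *\<^sub>R y) A \<le> (1 - t) * infdist x A + t * infdist y A"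
  proof (rule field_le_epsilon)
    fix e :: real
    assume "0 < e"
    obtain a where a: "a \<in> A" "dist x a < infdist x A + e"
      using infdist_less_witness[of x A "infdist x A + e"] \<open>A \<noteq> {}\<close> \<open>0 < e\<close> by auto
    obtain b where b: "b \<in> A" "dist y b < infdist y A + e"
      using infdist_less_witness[of y A "infdist y A + e"] \<open>A \<noteq> {}\<close> \<open>0 < e\<close> by auto
    have "(1 - t) *\<^sub>R a + t *\<^sub>R b \<in> A"
      using \<open>convex A\<close> a b t by (intro convexD) auto
    then have "infdist ((1 - t) *\<^sub>R x + t *\<^sub>R y) A
        \<le> norm (((1 - t) *\<^sub>R x + t *\<^sub>R y) - ((1 - t) *\<^sub>R a + t *\<^sub>R b))"
      by (metis infdist_le dist_norm)
    also have "\<dots> = norm ((1 - t) *\<^sub>R (x - a) + t *\<^sub>R (y - b))"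
      by (simp add: algebra_simps)
    also have "\<dots> \<le> (1 - t) * dist x a + t * dist y b"
      using t norm_triangle_ineq[of "(1 - t) *\<^sub>R (x - a)" "t *\<^sub>R (y - b)"] by (simp add: dist_norm)
    also have "\<dots> \<le> (1 - t) * (infdist x A + e) + t * (infdist y A + e)"
      using a b t by (intro add_mono mult_left_mono) auto
    also have "\<dots> = (1 - t) * infdist x A + t * infdist y A + e"
      by (simp add: algebra_simps)
    finally show "infdist ((1 - t) *\<^sub>R x + t *\<^sub>R y) A \<le> (1 - t) * infdist x A + t * infdist y A + e" .
  qed
qed fact

lemma uniformly_convex_infdist_attained:
  fixes x :: "'a::banach"
  assumes "uniformly_convex TYPE('a)" "A \<noteq> {}" "bounded A" "closed A" "convex A"
  obtains a where "a \<in> A" "dist x a = infdist x A"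
proof -
  have "bdd_below (dist x ` A)"
    by (intro bdd_belowI[of _ 0]) auto
  moreover have "continuous_on A (dist x)"
    by (intro continuous_intros)
  ultimately obtain a where a: "a \<in> A" "\<And>b. b \<in> A \<Longrightarrow> dist x a \<le> dist x b"
    using uniformly_convex_attains_min[OF assms(1-4) convex_on_dist[OF assms(5)]] by blast
  then have "infdist x A = dist x a"
    using \<open>A \<noteq> {}\<close> by (intro antisym infdist_le) (auto simp: infdist_notempty intro: cINF_greatest)
  with a(1) show ?thesis
    using that by simp
qed

lemma proximal_points_nonempty:
  fixes M N :: "'a::banach set"
  assumes uc: "uniformly_convex TYPE('a)"
    and M: "M \<noteq> {}" "bounded M" "closed M" "convex M"
    and N: "N \<noteq> {}" "bounded N" "closed N" "convex N"
  shows "proximal_points M N \<noteq> {}"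
proof -
  have "bdd_below ((\<lambda>x. infdist x N) ` M)"
    by (intro bdd_belowI[of _ 0]) (auto simp: infdist_nonneg)
  then obtain x where x: "x \<in> M" "\<And>y. y \<in> M \<Longrightarrow> infdist x N \<le> infdist y N"
    using uniformly_convex_attains_min[OF uc M(1-3), of "\<lambda>x. infdist x N"]
      convex_on_infdist[OF N(4,1) M(4)] continuous_on_infdist[OF continuous_on_id] by blast
  obtain z where z: "z \<in> N" "dist x z = infdist x N"
    using uniformly_convex_infdist_attained[OF uc N] .
  have "dist x z \<le> dist y b" if "y \<in> M" "b \<in> N" for y b
    using x(2)[OF that(1)] z(2) infdist_le[OF that(2), of y] by linarith
  then have "dist x z \<le> setdist M N"
    using M(1) N(1) by (intro le_setdistI)
  then have "norm (x - z) = setdist M N"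
    using setdist_le_dist[OF x(1) z(1)] by (simp add: dist_norm)
  with x(1) z(1) show ?thesis
    by (auto simp: proximal_points_def)
qed

lemma infdist_le_setdist_add_infdist_proximal_points:
  assumes "proximal_points M N \<noteq> {}"
  shows "infdist x N \<le> setdist M N + infdist x (proximal_points M N)"
proof (rule field_le_epsilon)
  fix e :: real
  assume "0 < e"
  then have "infdist x (proximal_points M N) < infdist x (proximal_points M N) + e"
    by simp
  from this assms obtain y where y: "y \<in> proximal_points M N"
    "dist x y < infdist x (proximal_points M N) + e"
    by (rule infdist_less_witness)
  then obtain z where "z \<in> N" "norm (y - z) = setdist M N"
    by (auto simp: proximal_points_def)
  then have "infdist y N \<le> setdist M N"
    by (metis infdist_le dist_norm)
  then show "infdist x N \<le> setdist M N + infdist x (proximal_points M N) + e"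
    using infdist_triangle[of x N y] y(2) by linarith
qed

section \<open>Asymptotic centers\<close>

text \<open>
  The limit superior of the distances \<open>norm (x n - y)\<close>, as a real number; it is meaningful for
  bounded \<open>x\<close>.
\<close>

definition asymptotic_radius :: "(nat \<Rightarrow> 'a::real_normed_vector) \<Rightarrow> 'a \<Rightarrow> real" where
  "asymptotic_radius x y = Inf {b. \<forall>\<^sub>F n in sequentially. norm (x n - y) \<le> b}"

lemma eventually_le_nonneg:
  assumes "\<forall>\<^sub>F n in sequentially. norm (x n - y) \<le> (b::real)"
  shows "0 \<le> b"
proof -
  obtain n where "norm (x n - y) \<le> b"
    using eventually_happens'[OF sequentially_bot assms] by blast
  then show ?thesis
    using norm_ge_zero order_trans by blast
qed

lemma asymptotic_radius_le:
  assumes "\<forall>\<^sub>F n in sequentially. norm (x n - y) \<le> b"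
  shows "asymptotic_radius x y \<le> b"
  unfolding asymptotic_radius_def
  using assms by (intro cInf_lower bdd_belowI[of _ 0]) (auto dest: eventually_le_nonneg)

lemma asymptotic_radius_less:
  assumes "bounded (range x)" "asymptotic_radius x y < b"
  shows "\<forall>\<^sub>F n in sequentially. norm (x n - y) \<le> b"
proof -
  obtain B where "\<And>n. norm (x n) \<le> B"
    using assms(1) by (auto simp: bounded_iff)
  then have "norm (x n - y) \<le> B + norm y" for n
    using norm_triangle_ineq4[of "x n" y] by (meson add_right_mono order_trans)
  then have "{b. \<forall>\<^sub>F n in sequentially. norm (x n - y) \<le> b} \<noteq> {}"
    by (auto intro!: exI[of _ "B + norm y"])
  from cInf_lessD[OF this] assms(2) obtain c
    where "\<forall>\<^sub>F n in sequentially. norm (x n - y) \<le> c" "c < b"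
    by (auto simp: asymptotic_radius_def)
  then show ?thesis
    by (auto elim: eventually_mono)
qed

lemma asymptotic_radius_nonneg:
  assumes "bounded (range x)"
  shows "0 \<le> asymptotic_radius x y"
proof (rule field_le_epsilon)
  fix e :: real
  assume "0 < e"
  then have "asymptotic_radius x y < asymptotic_radius x y + e"
    by simp
  from asymptotic_radius_less[OF assms this] show "0 \<le> asymptotic_radius x y + e"
    by (rule eventually_le_nonneg)
qed

lemma asymptotic_radius_convex_combination:
  assumes x: "bounded (range x)" and t: "0 \<le> t" "t \<le> 1"
  shows "asymptotic_radius x ((1 - t) *\<^sub>R y + t *\<^sub>R z)
    \<le> (1 - t) * asymptotic_radius x y + t * asymptotic_radius x z"
proof (rule field_le_epsilon)
  fix e :: real
  assume "0 < e"
  have "\<forall>\<^sub>F n in sequentially. norm (x n - y) \<le> asymptotic_radius x y + e"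
    "\<forall>\<^sub>F n in sequentially. norm (x n - z) \<le> asymptotic_radius x z + e"
    using asymptotic_radius_less[OF x] \<open>0 < e\<close> by auto
  then have "\<forall>\<^sub>F n in sequentially. norm (x n - ((1 - t) *\<^sub>R y + t *\<^sub>R z))
      \<le> (1 - t) * (asymptotic_radius x y + e) + t * (asymptotic_radius x z + e)"
  proof eventually_elim
    case (elim n)
    have "norm (x n - ((1 - t) *\<^sub>R y + t *\<^sub>R z)) = norm ((1 - t) *\<^sub>R (x n - y) + t *\<^sub>R (x n - z))"
      by (simp add: algebra_simps)
    also have "\<dots> \<le> (1 - t) * norm (x n - y) + t * norm (x n - z)"
      using t norm_triangle_ineq[of "(1 - t) *\<^sub>R (x n - y)" "t *\<^sub>R (x n - z)"] by simp
    also have "\<dots> \<le> (1 - t) * (asymptotic_radius x y + e) + t * (asymptotic_radius x z + e)"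
      using elim t by (intro add_mono mult_left_mono) auto
    finally show ?case .
  qed
  from asymptotic_radius_le[OF this]
  show "asymptotic_radius x ((1 - t) *\<^sub>R y + t *\<^sub>R z)
    \<le> (1 - t) * asymptotic_radius x y + t * asymptotic_radius x z + e"
    by (simp add: algebra_simps)
qed

lemma asymptotic_radius_triangle:
  assumes x: "bounded (range x)"
  shows "asymptotic_radius x y \<le> asymptotic_radius x z + norm (y - z)"
proof (rule field_le_epsilon)
  fix e :: real
  assume "0 < e"
  then have "\<forall>\<^sub>F n in sequentially. norm (x n - z) \<le> asymptotic_radius x z + e"
    using asymptotic_radius_less[OF x] by auto
  then have "\<forall>\<^sub>F n in sequentially. norm (x n - y) \<le> asymptotic_radius x z + norm (y - z) + e"
  proof eventually_elim
    case (elim n)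
    then show ?case
      using norm_triangle_ineq4[of "x n - z" "y - z"] by simp
  qed
  then show "asymptotic_radius x y \<le> asymptotic_radius x z + norm (y - z) + e"
    by (rule asymptotic_radius_le)
qed

lemma continuous_on_asymptotic_radius:
  assumes "bounded (range x)"
  shows "continuous_on S (asymptotic_radius x)"
  unfolding continuous_on_iff
proof (intro ballI allI impI)
  fix y and e :: real
  assume "0 < e"
  have "dist (asymptotic_radius x z) (asymptotic_radius x y) \<le> dist z y" for z
    using asymptotic_radius_triangle[OF assms, of y z] asymptotic_radius_triangle[OF assms, of z y]
    by (simp add: dist_real_def dist_norm norm_minus_commute)
  then show "\<exists>d>0. \<forall>z\<in>S. dist z y < d \<longrightarrow>
      dist (asymptotic_radius x z) (asymptotic_radius x y) < e"
    using \<open>0 < e\<close> by (meson le_less_trans)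
qed

lemma asymptotic_center_exists:
  fixes x :: "nat \<Rightarrow> 'a::banach"
  assumes "uniformly_convex TYPE('a)" and x: "bounded (range x)"
    and C: "C \<noteq> {}" "bounded C" "closed C" "convex C"
  obtains q where "q \<in> C" "\<And>y. y \<in> C \<Longrightarrow> asymptotic_radius x q \<le> asymptotic_radius x y"
proof (rule uniformly_convex_attains_min)
  show "convex_on C (asymptotic_radius x)"
    using asymptotic_radius_convex_combination[OF x] C(4) by (intro convex_onI) auto
  show "continuous_on C (asymptotic_radius x)"
    using x by (rule continuous_on_asymptotic_radius)
  show "bdd_below (asymptotic_radius x ` C)"
    using asymptotic_radius_nonneg[OF x] by (intro bdd_belowI[of _ 0]) auto
qed (use assms that in auto)

lemma asymptotic_center_unique:
  fixes x :: "nat \<Rightarrow> 'a::real_normed_vector"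
  assumes uc: "uniformly_convex TYPE('a)" and x: "bounded (range x)" and "convex C"
    and R: "\<And>y. y \<in> C \<Longrightarrow> R \<le> asymptotic_radius x y"
    and p: "p \<in> C" "asymptotic_radius x p \<le> R" and q: "q \<in> C" "asymptotic_radius x q \<le> R"
  shows "p = q"
proof (rule ccontr)
  assume "p \<noteq> q"
  then have "0 < norm (p - q)"
    by simp
  then obtain h where "0 < h" and h: "\<And>(x :: 'a) y t. norm x \<le> R + h \<Longrightarrow> norm y \<le> R + h \<Longrightarrow>
      t \<in> {1/2..1 - 1/2} \<Longrightarrow> R - h \<le> norm ((1 - t) *\<^sub>R x + t *\<^sub>R y) \<Longrightarrow> norm (x - y) < norm (p - q)"
    using uniformly_convex_annulus[OF uc, of "norm (p - q)" "1/2" R]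
    by (metis half_gt_zero_iff zero_less_one)
  have "\<forall>\<^sub>F n in sequentially. norm (x n - p) \<le> R + h"
    "\<forall>\<^sub>F n in sequentially. norm (x n - q) \<le> R + h"
    using asymptotic_radius_less[OF x] p(2) q(2) \<open>0 < h\<close> by auto
  then have "\<forall>\<^sub>F n in sequentially. norm (x n - ((1/2) *\<^sub>R p + (1/2) *\<^sub>R q)) \<le> R - h"
  proof eventually_elim
    case (elim n)
    have "\<not> norm ((x n - p) - (x n - q)) < norm (p - q)"
      by (simp add: norm_minus_commute)
    then have "\<not> R - h \<le> norm ((1 - 1/2) *\<^sub>R (x n - p) + (1/2) *\<^sub>R (x n - q))"
      using h[of "x n - p" "x n - q" "1/2"] elim by auto
    then show ?case
      by (simp add: algebra_simps flip: scaleR_add_left)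
  qed
  then have "asymptotic_radius x ((1/2) *\<^sub>R p + (1/2) *\<^sub>R q) \<le> R - h"
    by (rule asymptotic_radius_le)
  moreover have "(1/2) *\<^sub>R p + (1/2) *\<^sub>R q \<in> C"
    using \<open>convex C\<close> p(1) q(1) by (intro convexD) auto
  ultimately show False
    using R \<open>0 < h\<close> by fastforce
qed

text \<open>
  Shifting a sequence does not change its asymptotic radius at any point, so the last hypothesis
  makes the radius at \<open>F z\<close> at most the radius at \<open>z\<close>. Hence \<open>F\<close> fixes the unique minimizer.
\<close>

lemma fixed_point_by_asymptotic_center:
  fixes x :: "nat \<Rightarrow> 'a::banach"
  assumes uc: "uniformly_convex TYPE('a)" and x: "bounded (range x)"
    and C: "C \<noteq> {}" "bounded C" "closed C" "convex C" and "F ` C \<subseteq> C"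
    and F: "\<And>n z. z \<in> C \<Longrightarrow> norm (x (Suc n) - F z) \<le> norm (x n - z)"
  obtains q where "q \<in> C" "F q = q"
proof -
  obtain q where q: "q \<in> C" "\<And>y. y \<in> C \<Longrightarrow> asymptotic_radius x q \<le> asymptotic_radius x y"
    using asymptotic_center_exists[OF uc x C] by blast
  have "asymptotic_radius x (F q) \<le> asymptotic_radius x q"
  proof (rule field_le_epsilon)
    fix e :: real
    assume "0 < e"
    then have "\<forall>\<^sub>F n in sequentially. norm (x n - q) \<le> asymptotic_radius x q + e"
      using asymptotic_radius_less[OF x] by auto
    then have "\<forall>\<^sub>F n in sequentially. norm (x (Suc n) - F q) \<le> asymptotic_radius x q + e"
      by eventually_elim (use F[OF q(1)] order_trans in blast)
    then show "asymptotic_radius x (F q) \<le> asymptotic_radius x q + e"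
      by (intro asymptotic_radius_le) (subst (asm) eventually_sequentially_Suc)
  qed
  then have "F q = q"
    using q \<open>F ` C \<subseteq> C\<close> by (intro asymptotic_center_unique[OF uc x C(4) q(2)]) auto
  with q(1) show ?thesis
    by (rule that)
qed

section \<open>The iteration\<close>

lemma norm_combination_le:
  fixes a b q :: "'a::real_normed_vector"
  assumes "0 \<le> t" "t \<le> 1"
  shows "norm ((1 - t) *\<^sub>R a + t *\<^sub>R b - q) \<le> (1 - t) * norm (a - q) + t * norm (b - q)"
proof -
  have "(1 - t) *\<^sub>R a + t *\<^sub>R b - q = (1 - t) *\<^sub>R (a - q) + t *\<^sub>R (b - q)"
    by (simp add: algebra_simps)
  then show ?thesis
    using assms norm_triangle_ineq[of "(1 - t) *\<^sub>R (a - q)" "t *\<^sub>R (b - q)"] by simp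
qed

locale ishikawa_iteration =
  fixes M :: "'a::real_normed_vector set" and F :: "'a \<Rightarrow> 'a" and \<epsilon> :: real
    and \<eta> \<delta> :: "nat \<Rightarrow> real" and w :: "nat \<Rightarrow> 'a"
  assumes convex: "convex M" and maps: "F ` M \<subseteq> M" and eps: "0 < \<epsilon>"
    and eta: "\<eta> n \<in> {\<epsilon><..<1 - \<epsilon>}" and delta: "\<delta> n \<in> {\<epsilon><..<1 - \<epsilon>}"
    and start: "w 0 \<in> M"
    and step: "w (Suc n) =
      (1 - \<eta> n) *\<^sub>R w n + \<eta> n *\<^sub>R F ((1 - \<delta> n) *\<^sub>R w n + \<delta> n *\<^sub>R F (w n))"
begin

definition u :: "nat \<Rightarrow> 'a" where
  "u n = (1 - \<delta> n) *\<^sub>R w n + \<delta> n *\<^sub>R F (w n)"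

lemma w_Suc: "w (Suc n) = (1 - \<eta> n) *\<^sub>R w n + \<eta> n *\<^sub>R F (u n)"
  unfolding u_def by (rule step)

lemma u_in:
  assumes "w n \<in> M"
  shows "u n \<in> M"
  using convex maps assms delta[of n] eps unfolding u_def by (intro convexD) auto

lemma w_in: "w n \<in> M"
proof (induction n)
  case 0
  show ?case by (rule start)
next
  case (Suc n)
  then show ?case
    using convex maps u_in eta[of n] eps unfolding w_Suc by (intro convexD) auto
qed

text \<open>
  Below, \<open>q\<close> is a point, in \<open>M\<close> or not, from which \<open>F\<close> does not move the points of \<open>M\<close> away; in the
  application it is a fixed point of \<open>F\<close> in the other set.
\<close>

lemma norm_u_le:
  assumes "\<And>x. x \<in> M \<Longrightarrow> norm (F x - q) \<le> norm (x - q)"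
  shows "norm (u n - q) \<le> norm (w n - q)"
proof -
  have \<delta>: "0 \<le> \<delta> n" "\<delta> n \<le> 1"
    using delta[of n] eps by auto
  have "norm (u n - q) \<le> (1 - \<delta> n) * norm (w n - q) + \<delta> n * norm (F (w n) - q)"
    unfolding u_def by (rule norm_combination_le[OF \<delta>])
  also have "\<dots> \<le> (1 - \<delta> n) * norm (w n - q) + \<delta> n * norm (w n - q)"
    using assms[OF w_in] \<delta> by (intro add_mono mult_left_mono) auto
  finally show ?thesis
    by (simp add: algebra_simps)
qed

lemma norm_w_Suc_le:
  assumes "\<And>x. x \<in> M \<Longrightarrow> norm (F x - q) \<le> norm (x - q)"
  shows "norm (w (Suc n) - q) \<le> (1 - \<eta> n) * norm (w n - q) + \<eta> n * norm (u n - q)"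
proof -
  have \<eta>: "0 \<le> \<eta> n" "\<eta> n \<le> 1"
    using eta[of n] eps by auto
  have "norm (w (Suc n) - q) \<le> (1 - \<eta> n) * norm (w n - q) + \<eta> n * norm (F (u n) - q)"
    unfolding w_Suc by (rule norm_combination_le[OF \<eta>])
  also have "\<dots> \<le> (1 - \<eta> n) * norm (w n - q) + \<eta> n * norm (u n - q)"
    using assms[OF u_in[OF w_in]] \<eta> by (intro add_mono mult_left_mono) auto
  finally show ?thesis .
qed

lemma decseq_norm:
  assumes "\<And>x. x \<in> M \<Longrightarrow> norm (F x - q) \<le> norm (x - q)"
  shows "decseq (\<lambda>n. norm (w n - q))"
proof (rule decseq_SucI)
  fix n
  have "norm (w (Suc n) - q) \<le> (1 - \<eta> n) * norm (w n - q) + \<eta> n * norm (u n - q)"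
    by (rule norm_w_Suc_le[OF assms])
  also have "\<dots> \<le> (1 - \<eta> n) * norm (w n - q) + \<eta> n * norm (w n - q)"
    using norm_u_le[OF assms] eta[of n] eps by (intro add_mono mult_left_mono) auto
  finally show "norm (w (Suc n) - q) \<le> norm (w n - q)"
    by (simp add: algebra_simps)
qed

text \<open>
  The distances \<open>norm (w n - q)\<close> decrease to some \<open>r\<close>. In the bound for \<open>norm (w (Suc n) - q)\<close> the
  distance \<open>norm (u n - q)\<close> has a weight of at least \<open>\<epsilon>\<close>, so it cannot fall far below \<open>r\<close> either. As
  \<open>u n\<close> is a combination of \<open>w n\<close> and \<open>F (w n)\<close>, whose distances from \<open>q\<close> do not exceed \<open>r\<close> by much,
  uniform convexity forces these two points together.
\<close>

lemma asymptotically_regular: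
  assumes uc: "uniformly_convex TYPE('a)"
    and q: "\<And>x. x \<in> M \<Longrightarrow> norm (F x - q) \<le> norm (x - q)"
  shows "(\<lambda>n. norm (w n - F (w n))) \<longlonglongrightarrow> 0"
proof -
  obtain r where lim: "(\<lambda>n. norm (w n - q)) \<longlonglongrightarrow> r" and r: "\<And>n. r \<le> norm (w n - q)"
    using decseq_convergent[OF decseq_norm[OF q], of 0] by auto
  have "(\<lambda>n. w n - F (w n)) \<longlonglongrightarrow> 0"
  proof (rule LIMSEQ_I)
    fix e :: real
    assume "0 < e"
    obtain h where "0 < h" and h: "\<And>(x :: 'a) y t. norm x \<le> r + h \<Longrightarrow> norm y \<le> r + h \<Longrightarrow>
        t \<in> {\<epsilon>..1 - \<epsilon>} \<Longrightarrow> r - h \<le> norm ((1 - t) *\<^sub>R x + t *\<^sub>R y) \<Longrightarrow> norm (x - y) < e"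
      using uniformly_convex_annulus[OF uc \<open>0 < e\<close> eps] by blast
    have "r < r + \<epsilon> * h"
      using eps \<open>0 < h\<close> by simp
    from order_tendstoD(2)[OF lim this] obtain k
      where k: "\<And>n. n \<ge> k \<Longrightarrow> norm (w n - q) < r + \<epsilon> * h"
      by (auto simp: eventually_sequentially)
    have "norm (w n - F (w n)) < e" if "n \<ge> k" for n
    proof -
      have \<eta>: "\<epsilon> < \<eta> n" "\<eta> n < 1"
        using eta[of n] eps by auto
      have "\<epsilon> * h \<le> \<eta> n * h" "\<epsilon> * h \<le> h"
        using \<eta> eps \<open>0 < h\<close> by auto
      have "r \<le> (1 - \<eta> n) * norm (w n - q) + \<eta> n * norm (u n - q)"
        using r[of "Suc n"] norm_w_Suc_le[OF q, of n] by linarith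
      also have "\<dots> \<le> (1 - \<eta> n) * (r + \<epsilon> * h) + \<eta> n * norm (u n - q)"
        using k[OF that] \<eta> eps by (intro add_mono mult_left_mono) auto
      also have "\<dots> \<le> (1 - \<eta> n) * r + \<epsilon> * h + \<eta> n * norm (u n - q)"
        using \<eta> eps \<open>0 < h\<close> by (simp add: algebra_simps)
      also have "\<dots> \<le> (1 - \<eta> n) * r + \<eta> n * h + \<eta> n * norm (u n - q)"
        using \<open>\<epsilon> * h \<le> \<eta> n * h\<close> by simp
      finally have "\<eta> n * (r - h) \<le> \<eta> n * norm (u n - q)"
        by (simp add: algebra_simps)
      then have "r - h \<le> norm (u n - q)"
        using \<eta> eps by simp
      also have "u n - q = (1 - \<delta> n) *\<^sub>R (w n - q) + \<delta> n *\<^sub>R (F (w n) - q)"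
        by (simp add: u_def algebra_simps)
      finally have "norm ((w n - q) - (F (w n) - q)) < e"
        using k[OF that] q[OF w_in, of n] delta[of n] \<open>\<epsilon> * h \<le> h\<close>
        by (intro h[of _ _ "\<delta> n"]) auto
      then show ?thesis
        by simp
    qed
    then show "\<exists>k. \<forall>n\<ge>k. norm (w n - F (w n) - 0) < e"
      by auto
  qed
  then show ?thesis
    by (rule tendsto_norm_zero)
qed

end

text \<open>
  Let \<open>p\<close> be a limit of iterates \<open>w (s n)\<close>; it is proximal, with partner \<open>z\<close> say. Although \<open>F\<close> may
  be discontinuous at \<open>p\<close>, both \<open>p\<close>, as a limit of \<open>F (w (s n))\<close>, and \<open>F p\<close> have distance at most
  \<open>setdist M N\<close> from \<open>F z\<close>, so they coincide. Likewise \<open>z\<close> and \<open>F z\<close> are both nearest to \<open>p\<close>.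
\<close>

lemma proximal_cluster_point_fixed:
  fixes M N :: "'a::real_normed_vector set"
  assumes uc: "uniformly_convex TYPE('a)" and "convex M" "convex N"
    and "F ` M \<subseteq> M" "F ` N \<subseteq> N"
    and F: "\<And>x z. x \<in> M \<Longrightarrow> z \<in> N \<Longrightarrow> norm (F x - F z) \<le> norm (x - z)"
    and v: "\<And>n :: nat. v n \<in> M" "v \<longlonglongrightarrow> p" "(\<lambda>n. F (v n)) \<longlonglongrightarrow> p"
    and p: "p \<in> M" and z: "z \<in> N" "norm (p - z) \<le> setdist M N"
  shows "F p = p" "F z = z"
proof -
  have below: "setdist M N \<le> norm (x - y)" if "x \<in> M" "y \<in> N" for x y
    using setdist_le_dist[OF that] by (simp add: dist_norm)
  have "F p \<in> M" "F z \<in> N"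
    using assms(4,5) p z(1) by auto
  have "norm (p - F z) \<le> norm (p - z)"
  proof (rule LIMSEQ_le)
    show "(\<lambda>n. norm (F (v n) - F z)) \<longlonglongrightarrow> norm (p - F z)"
      using v(3) by (intro tendsto_intros)
    show "(\<lambda>n. norm (v n - z)) \<longlonglongrightarrow> norm (p - z)"
      using v(2) by (intro tendsto_intros)
  qed (use F v(1) z(1) in auto)
  then have pFz: "norm (p - F z) \<le> setdist M N"
    using z(2) by linarith
  have "norm (F p - F z) \<le> setdist M N"
    using F[OF p z(1)] z(2) by linarith
  then show "F p = p"
    using pFz p \<open>F p \<in> M\<close> \<open>F z \<in> N\<close> below
    by (intro uniformly_convex_nearest_point_unique[OF uc \<open>convex M\<close>, of "setdist M N" "F z"]) auto
  show "F z = z"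
    using pFz p z \<open>F z \<in> N\<close> below[OF p]
    by (intro uniformly_convex_nearest_point_unique[OF uc \<open>convex N\<close>, of "setdist M N" p])
      (simp_all add: norm_minus_commute)
qed

section \<open>Convergence of the iteration\<close>

theorem theorem2p1:
  fixes M N :: "'a::banach set"
    and F :: "'a \<Rightarrow> 'a"
    and \<epsilon> :: real
    and \<eta> \<delta> :: "nat \<Rightarrow> real"
    and w :: "nat \<Rightarrow> 'a"
  assumes "uniformly_convex TYPE('a)"
    and "M \<noteq> {}" "bounded M" "closed M" "convex M"
    and "N \<noteq> {}" "bounded N" "closed N" "convex N"
    and "F \<in> M \<union> N \<rightarrow> M \<union> N"
    and "F ` M \<subseteq> M" "F ` N \<subseteq> N"
    and "\<And>x z. x \<in> M \<Longrightarrow> z \<in> N \<Longrightarrow> norm (F x - F z) \<le> norm (x - z)"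
    and "\<epsilon> \<in> {0<..<1/2}"
    and "\<And>n. \<eta> n \<in> {\<epsilon><..<1 - \<epsilon>}"
    and "\<And>n. \<delta> n \<in> {\<epsilon><..<1 - \<epsilon>}"
    and "w 0 \<in> M"
    and "\<And>n. w (Suc n) =
           (1 - \<eta> n) *\<^sub>R w n + \<eta> n *\<^sub>R F ((1 - \<delta> n) *\<^sub>R w n + \<delta> n *\<^sub>R F (w n))"
    and "(\<lambda>n. infdist (w n) (proximal_points M N)) \<longlonglongrightarrow> 0"
  shows "(\<lambda>n. norm (w n - F (w n))) \<longlonglongrightarrow> 0 \<and>
         ((\<exists>K. compact K \<and> F ` M \<subseteq> K) \<longrightarrow> (\<exists>p\<in>M \<union> N. F p = p \<and> w \<longlonglongrightarrow> p))"
proof (intro conjI impI)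
  note uc = assms(1) and M = assms(2-5) and N = assms(6-9)
    and FM = assms(11) and FN = assms(12) and F = assms(13)
  interpret ishikawa_iteration M F \<epsilon> \<eta> \<delta> w
    using assms(5,11,14-18) by unfold_locales auto
  have quasi: "norm (F x - z) \<le> norm (x - z)" if "x \<in> M" "z \<in> N" "F z = z" for x z
    using F[OF that(1,2)] that(3) by simp
  define x where "x n = (F ^^ n) (w 0)" for n
  have x: "x n \<in> M" for n
    using start FM by (induction n) (auto simp: x_def)
  have "bounded (range x)"
    using x by (intro bounded_subset[OF \<open>bounded M\<close>]) auto
  moreover have "norm (x (Suc n) - F z) \<le> norm (x n - z)" if "z \<in> N" for n z
    using F[OF x that] by (simp add: x_def)
  ultimately obtain q where "q \<in> N" "F q = q"
    using fixed_point_by_asymptotic_center[OF uc _ N FN] by blast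
  then have regular: "(\<lambda>n. norm (w n - F (w n))) \<longlonglongrightarrow> 0"
    using asymptotically_regular[OF uc] quasi by blast
  then show "(\<lambda>n. norm (w n - F (w n))) \<longlonglongrightarrow> 0" .
  assume "\<exists>K. compact K \<and> F ` M \<subseteq> K"
  then obtain K where "compact K" "F ` M \<subseteq> K"
    by blast
  then have "\<forall>n. F (w n) \<in> K"
    using w_in by auto
  then obtain p s where "strict_mono s" and "((\<lambda>n. F (w n)) \<circ> s) \<longlonglongrightarrow> p"
    using \<open>compact K\<close> unfolding compact_def by meson
  then have Fws: "(\<lambda>n. F (w (s n))) \<longlonglongrightarrow> p"
    by (simp add: o_def)
  have "(\<lambda>n. w (s n) - F (w (s n))) \<longlonglongrightarrow> 0"
    using LIMSEQ_subseq_LIMSEQ[OF regular \<open>strict_mono s\<close>] tendsto_norm_zero_iff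
    by (force simp: o_def)
  from tendsto_add[OF this Fws] have ws: "(\<lambda>n. w (s n)) \<longlonglongrightarrow> p"
    by simp
  have "p \<in> M"
    using \<open>closed M\<close> w_in ws by (rule closed_sequentially)
  have "infdist p N \<le> setdist M N"
  proof (rule LIMSEQ_le)
    show "(\<lambda>n. infdist (w (s n)) N) \<longlonglongrightarrow> infdist p N"
      using ws by (rule tendsto_infdist)
    have "(\<lambda>n. infdist (w (s n)) (proximal_points M N)) \<longlonglongrightarrow> 0"
      using LIMSEQ_subseq_LIMSEQ[OF assms(19) \<open>strict_mono s\<close>] by (simp add: o_def)
    from tendsto_add[OF tendsto_const this]
    show "(\<lambda>n. setdist M N + infdist (w (s n)) (proximal_points M N)) \<longlonglongrightarrow> setdist M N"
      by simp
    show "\<exists>k. \<forall>n\<ge>k. infdist (w (s n)) N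
        \<le> setdist M N + infdist (w (s n)) (proximal_points M N)"
      using infdist_le_setdist_add_infdist_proximal_points[OF proximal_points_nonempty[OF uc M N]]
      by blast
  qed
  then obtain z where "z \<in> N" and pz: "norm (p - z) \<le> setdist M N"
    using uniformly_convex_infdist_attained[OF uc N, of p] by (metis dist_norm)
  then have "F p = p" "F z = z"
    using proximal_cluster_point_fixed[OF uc M(4) N(4) FM FN F w_in ws Fws \<open>p \<in> M\<close>] by auto
  \<comment> \<open>The distances to \<open>z\<close> decrease along the whole sequence, so their limit can be read off from
    the subsequence.\<close>
  obtain r where r: "(\<lambda>n. norm (w n - z)) \<longlonglongrightarrow> r"
    using decseq_convergent[OF decseq_norm[OF quasi[OF _ \<open>z \<in> N\<close> \<open>F z = z\<close>]], of 0] by auto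
  have "(\<lambda>n. norm (w (s n) - z)) \<longlonglongrightarrow> norm (p - z)"
    using ws by (intro tendsto_intros)
  moreover have "(\<lambda>n. norm (w (s n) - z)) \<longlonglongrightarrow> r"
    using LIMSEQ_subseq_LIMSEQ[OF r \<open>strict_mono s\<close>] by (simp add: o_def)
  ultimately have "r = norm (p - z)"
    by (rule LIMSEQ_unique[symmetric])
  have below: "norm (p - z) \<le> norm (y - z)" if "y \<in> M" for y
    using setdist_le_dist[OF that \<open>z \<in> N\<close>] pz by (simp add: dist_norm)
  have "w \<longlonglongrightarrow> p"
    using uniformly_convex_nearest_point_attracts[OF uc M(4) below \<open>p \<in> M\<close> order_refl w_in] r
      \<open>r = norm (p - z)\<close> by simp
  with \<open>p \<in> M\<close> \<open>F p = p\<close> show "\<exists>p\<in>M \<union> N. F p = p \<and> w \<longlonglongrightarrow> p"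
    by blast
qed

end
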